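(* Let $r\ge 0$ be an integer and $\mu_r\in\mathbb{C}$. Let $\lambda^{tX}_{n,m}$ be the coefficient of $x^m$ in $P^t_n(\mu_r;r)(x)$ (with $\lambda^{tX}_{0,-1}=0$) and let ${\xi^t}^{(n)}_1,\dots,{\xi^t}^{(n)}_n$ be the zeros of $P^t_n(\mu_r;r)$. Then: \begin{enumerate} \item $\lambda^{tX}_{k,k-1}=0=\sum_{i=1}^{k}{\xi^t}^{(k)}_i$ for $0\le k\le r$. \item $\lambda^{tX}_{n,n-1}=-\mu_r$, equivalently $\sum_{i=1}^{n}{\xi^t}^{(n)}_i=\mu_r$, for $n\ge r+1$. \item $\lambda^{tX}_{2n,0}=\frac{(-1)^n}{2^{2n}}$, equivalently $\prod_{k=1}^{2n}{\xi^t}^{(2n)}_k=\frac{(-1)^n}{2^{2n}}$, and hence $P^t_{2n}(\mu_r;r)(0)\ne0$, for $n\ge0$. \item If $r=2r'+1$ is odd, then $\lambda^{tX}_{2n+1,0}=0$, equivalently $\prod_{k=1}^{2n+1}{\xi^t}^{(2n+1)}_k=0$, equivalently $P^t_{2n+1}(\mu_r;r)(0)=0$, for $n\ge0$. \item If $r=2r'$ is even, then $\lambda^{tX}_{2k'+1,0}=0$, equivalently $\prod_{k=1}^{2k'+1}{\xi^t}^{(2k'+1)}_k=0$, equivalently $P^t_{2k'+1}(\mu_r;r)(0)=0$, for $0\le k'\le r'-1$; and $\lambda^{tX}_{2n+1,0}=\mu_r\frac{(-1)^{n+1}}{2^{2n}}$, equivalently $\prod_{k=1}^{2n+1}{\xi^t}^{(2n+1)}_k=\mu_r\frac{(-1)^{n}}{2^{2n}}$,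 and hence (when $\mu_r\neq 0$) $P^t_{2n+1}(\mu_r;r)(0)\ne0$, for $n\ge r'$. \end{enumerate}
   Context: For an integer $r\ge 0$ and $\mu_r\in\mathbb{C}$, the $r$th-perturbed by translation sequence $\{P^t_n(\mu_r;r)\}_{n\ge 0}$ of the monic Chebyshev polynomials of the second kind is the monic sequence with $P^t_0=1$, $P^t_1(x)=x-\beta_0$, $P^t_{n+2}(x)=(x-\beta_{n+1})P^t_{n+1}(x)-\frac14P^t_n(x)$ for $n\ge 0$, where $\beta_r=\mu_r$ and $\beta_n=0$ for $n\ne r$. Zeros are complex zeros listed with multiplicity; empty sums are $0$ and empty products are $1$. *)

theory Defs
  imports Complex_Main "HOL-Computational_Algebra.Computational_Algebra"
begin

definition beta_t :: "nat \<Rightarrow> complex \<Rightarrow> nat \<Rightarrow> complex" where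
  "beta_t r \<mu> n = (if n = r then \<mu> else 0)"

(* The monic Chebyshev polynomials of the second kind (recurrence coefficients 0 and 1/4),
   with the r-th coefficient beta_r = 0 translated to mu. *)
fun Pt :: "nat \<Rightarrow> complex \<Rightarrow> nat \<Rightarrow> complex poly" where
  "Pt r \<mu> 0 = 1"
| "Pt r \<mu> (Suc 0) = [:- beta_t r \<mu> 0, 1:]"
| "Pt r \<mu> (Suc (Suc n)) =
     [:- beta_t r \<mu> (Suc n), 1:] * Pt r \<mu> (Suc n) - smult (1/4) (Pt r \<mu> n)"

(* The second index is an integer so that the coefficient with indices (0, -1) makes sense;
   it is 0 by convention. *)
definition lambda_tX :: "nat \<Rightarrow> complex \<Rightarrow> nat \<Rightarrow> int \<Rightarrow> complex" where
  "lambda_tX r \<mu> n m = (if m < 0 then 0 else coeff (Pt r \<mu> n) (nat m))"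

(* For each n, the list x n 1, ..., x n n enumerates the zeros of the n-th polynomial,
   each repeated according to its multiplicity, in an arbitrary order. *)
definition zeros_t :: "nat \<Rightarrow> complex \<Rightarrow> (nat \<Rightarrow> nat \<Rightarrow> complex) \<Rightarrow> bool" where
  "zeros_t r \<mu> x \<longleftrightarrow> (\<forall>n. image_mset (x n) (mset_set {1..n}) = proots (Pt r \<mu> n))"

end

theory Submission
  imports Defs
begin

text \<open>
  The subleading and the constant coefficient of each polynomial follow from the recurrence by
  induction. At \<open>0\<close> the recurrence reads \<open>c\<^sub>n\<^sub>+\<^sub>2 = - \<beta>\<^sub>n\<^sub>+\<^sub>1 c\<^sub>n\<^sub>+\<^sub>1 - c\<^sub>n / 4\<close>: the perturbation
  cannot reach the even-indexed values, since for odd \<open>r\<close> it is multiplied by \<open>c\<^sub>r = 0\<close>, and for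
  even \<open>r\<close> it first enters at \<open>c\<^sub>r\<^sub>+\<^sub>1\<close>. Sums and products of zeros then come from Vieta's
  formulas for the multiset of roots.
\<close>

lemma degree_prod_mset_linear_le:
  fixes A :: "'a::comm_ring_1 multiset"
  shows "degree (\<Prod>a\<in>#A. [:- a, 1:]) \<le> size A"
proof (induction A)
  case (add a A)
  have "degree ([:- a, 1:] * (\<Prod>a\<in>#A. [:- a, 1:])) \<le> degree [:- a, 1:] + degree (\<Prod>a\<in>#A. [:- a, 1:])"
    by (rule degree_mult_le)
  also have "\<dots> \<le> 1 + size A"
    using add by simp
  finally show ?case by simp
qed simp

lemma coeff_size_prod_mset_linear:
  fixes A :: "'a::comm_ring_1 multiset"
  shows "coeff (\<Prod>a\<in>#A. [:- a, 1:]) (size A) = 1"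
proof (induction A)
  case (add a A)
  then show ?case
    using degree_prod_mset_linear_le[of A] by (simp add: coeff_eq_0)
qed simp

text \<open>Vieta: a new factor \<open>[:- a, 1:]\<close> shifts the old coefficient up and adds
  \<open>- a\<close> times the leading coefficient, which is 1.\<close>

lemma coeff_pred_size_prod_mset_linear:
  fixes A :: "'a::comm_ring_1 multiset"
  shows "size A = Suc n \<Longrightarrow> coeff (\<Prod>a\<in>#A. [:- a, 1:]) n = - \<Sum>\<^sub># A"
proof (induction A arbitrary: n)
  case (add a A)
  then show ?case
    using coeff_size_prod_mset_linear[of A] by (cases n) auto
qed simp

lemma coeff_0_prod_mset_linear:
  fixes A :: "'a::comm_ring_1 multiset"
  shows "coeff (\<Prod>a\<in>#A. [:- a, 1:]) 0 = (-1) ^ size A * \<Prod>\<^sub># A"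
  by (induction A) simp_all

text \<open>One induction carries both facts: the earlier degrees determine the leading coefficient,
  and its being nonzero turns the upper bound on the degree into an equality.\<close>

lemma Pt_monic: "degree (Pt r \<mu> n) = n \<and> coeff (Pt r \<mu> n) n = 1"
proof (induction r \<mu> n rule: Pt.induct)
  case (3 r \<mu> n)
  have c: "coeff (Pt r \<mu> (Suc (Suc n))) (Suc (Suc n)) = 1"
    using 3 by (simp add: coeff_eq_0)
  have "degree (Pt r \<mu> (Suc (Suc n))) \<le> Suc (Suc n)"
    unfolding Pt.simps
    by (intro degree_diff_le order.trans[OF degree_mult_le] order.trans[OF degree_smult_le])
      (use 3 in simp_all)
  with c show ?case
    by (metis le_antisym le_degree one_neq_zero)
qed simp_all

text \<open>Each recurrence step subtracts one \<open>beta_t\<close> from the subleading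
  coefficient, while the term with 1/4 has too low a degree to contribute. The result is minus the
  sum of \<open>beta_t r \<mu> i\<close> over \<open>i \<le> n\<close>.\<close>

lemma coeff_Pt_subleading:
  "coeff (Pt r \<mu> (Suc n)) n = (if r \<le> n then - \<mu> else 0)"
proof -
  \<comment> \<open>The index is shifted to fit \<open>Pt.induct\<close>. At \<open>m = 0\<close>
    the truncated \<open>m - 1\<close> is 0, so the constant coefficient 1 is read off.\<close>
  have "coeff (Pt r \<mu> m) (m - 1) = (if r < m then - \<mu> else if m = 0 then 1 else 0)" for m
  proof (induction r \<mu> m rule: Pt.induct)
    case (3 r \<mu> n)
    then show ?case
      using Pt_monic[of r \<mu> "Suc n"] Pt_monic[of r \<mu> n]
      by (auto simp: beta_t_def coeff_eq_0 coeff_pCons split: nat.split)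
  qed (simp_all add: beta_t_def)
  from this[of "Suc n"] show ?thesis
    by auto
qed

lemma coeff_0_Pt_rec:
  "coeff (Pt r \<mu> (Suc (Suc n))) 0 =
     - beta_t r \<mu> (Suc n) * coeff (Pt r \<mu> (Suc n)) 0 - coeff (Pt r \<mu> n) 0 / 4"
  by simp

text \<open>The two parities are proved together, since the recurrence feeds each into the other
  through \<open>beta_t\<close>.\<close>

lemma coeff_0_Pt:
  "coeff (Pt r \<mu> (2 * n)) 0 = (-1) ^ n / 2 ^ (2 * n)"
  "coeff (Pt r \<mu> (2 * n + 1)) 0 =
     (if even r \<and> r \<le> 2 * n then \<mu> * ((-1) ^ (n + 1) / 2 ^ (2 * n)) else 0)"
proof (induction n)
  case 0
  show "coeff (Pt r \<mu> (2 * 0)) 0 = (-1) ^ 0 / 2 ^ (2 * 0)"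
    "coeff (Pt r \<mu> (2 * 0 + 1)) 0 =
       (if even r \<and> r \<le> 2 * 0 then \<mu> * ((-1) ^ (0 + 1) / 2 ^ (2 * 0)) else 0)"
    by (auto simp: beta_t_def)
next
  case (Suc n)
  show ev: "coeff (Pt r \<mu> (2 * Suc n)) 0 = (-1) ^ Suc n / 2 ^ (2 * Suc n)"
  proof -
    have "beta_t r \<mu> (Suc (2 * n)) * coeff (Pt r \<mu> (Suc (2 * n))) 0 = 0"
      using Suc by (auto simp: beta_t_def simp del: Pt.simps)
    then have "coeff (Pt r \<mu> (2 * Suc n)) 0 = - coeff (Pt r \<mu> (2 * n)) 0 / 4"
      using coeff_0_Pt_rec[of r \<mu> "2 * n"] by (simp del: Pt.simps)
    then show ?thesis
      using Suc by (simp del: Pt.simps)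
  qed
  have rec: "coeff (Pt r \<mu> (2 * Suc n + 1)) 0 =
      - beta_t r \<mu> (2 * Suc n) * ((-1) ^ Suc n / 2 ^ (2 * Suc n)) - coeff (Pt r \<mu> (2 * n + 1)) 0 / 4"
    using coeff_0_Pt_rec[of r \<mu> "Suc (2 * n)"] ev by (simp del: Pt.simps)
  \<comment> \<open>At \<open>r = 2 * Suc n\<close> the perturbation enters and the previous
    odd-indexed value is 0. In the other cases \<open>beta_t\<close> vanishes here, and the previous
    value is multiplied by -1/4.\<close>
  have "odd r \<or> even r \<and> r \<le> 2 * n \<or> r = 2 * Suc n \<or> r > 2 * Suc n"
    by presburger
  then consider "odd r" | "even r" "r \<le> 2 * n" | "r = 2 * Suc n" | "r > 2 * Suc n"
    by blast
  then show "coeff (Pt r \<mu> (2 * Suc n + 1)) 0 =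
      (if even r \<and> r \<le> 2 * Suc n then \<mu> * ((-1) ^ (Suc n + 1) / 2 ^ (2 * Suc n)) else 0)"
    unfolding rec Suc by cases (auto simp: beta_t_def)
qed

lemma Pt_vieta:
  assumes "zeros_t r \<mu> \<xi>"
  shows "n > 0 \<Longrightarrow> coeff (Pt r \<mu> n) (n - 1) = - (\<Sum>i=1..n. \<xi> n i)"
    and "coeff (Pt r \<mu> n) 0 = (-1) ^ n * (\<Prod>i=1..n. \<xi> n i)"
proof -
  define A where "A = image_mset (\<xi> n) (mset_set {1..n})"
  have A: "proots (Pt r \<mu> n) = A"
    using assms by (simp add: zeros_t_def A_def)
  \<comment> \<open>Over the complex numbers the polynomial splits, and being monic it leaves no
    scalar factor.\<close>
  have P: "Pt r \<mu> n = (\<Prod>a\<in>#A. [:- a, 1:])"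
    using complex_poly_decompose_multiset[of "Pt r \<mu> n"] Pt_monic[of r \<mu> n] A by simp
  have sz: "size A = n"
    by (simp add: A_def)
  have sm: "\<Sum>\<^sub># A = (\<Sum>i=1..n. \<xi> n i)" and pr: "\<Prod>\<^sub># A = (\<Prod>i=1..n. \<xi> n i)"
    by (simp_all add: A_def sum_unfold_sum_mset prod_unfold_prod_mset)
  show "n > 0 \<Longrightarrow> coeff (Pt r \<mu> n) (n - 1) = - (\<Sum>i=1..n. \<xi> n i)"
    using coeff_pred_size_prod_mset_linear[of A "n - 1"] by (simp add: P sz sm)
  show "coeff (Pt r \<mu> n) 0 = (-1) ^ n * (\<Prod>i=1..n. \<xi> n i)"
    using coeff_0_prod_mset_linear[of A] by (simp add: P sz pr)
qed

theorem proposition5p4: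
  fixes r :: nat and \<mu> :: complex and \<xi> :: "nat \<Rightarrow> nat \<Rightarrow> complex"
  assumes zeros: "zeros_t r \<mu> \<xi>"
  shows
    "(\<forall>k\<le>r. lambda_tX r \<mu> k (int k - 1) = 0 \<and> (\<Sum>i=1..k. \<xi> k i) = 0) \<and>
     (\<forall>n\<ge>r+1. lambda_tX r \<mu> n (int n - 1) = - \<mu> \<and>
        (lambda_tX r \<mu> n (int n - 1) = - \<mu> \<longleftrightarrow> (\<Sum>i=1..n. \<xi> n i) = \<mu>)) \<and>
     (\<forall>n. lambda_tX r \<mu> (2*n) 0 = (-1)^n / 2^(2*n) \<and>
        (lambda_tX r \<mu> (2*n) 0 = (-1)^n / 2^(2*n) \<longleftrightarrow>
           (\<Prod>k=1..2*n. \<xi> (2*n) k) = (-1)^n / 2^(2*n)) \<and>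
        poly (Pt r \<mu> (2*n)) 0 \<noteq> 0) \<and>
     (\<forall>r'. r = 2*r' + 1 \<longrightarrow>
        (\<forall>n. lambda_tX r \<mu> (2*n+1) 0 = 0 \<and>
           (lambda_tX r \<mu> (2*n+1) 0 = 0 \<longleftrightarrow> (\<Prod>k=1..2*n+1. \<xi> (2*n+1) k) = 0) \<and>
           ((\<Prod>k=1..2*n+1. \<xi> (2*n+1) k) = 0 \<longleftrightarrow> poly (Pt r \<mu> (2*n+1)) 0 = 0))) \<and>
     (\<forall>r'. r = 2*r' \<longrightarrow>
        (\<forall>k'<r'. lambda_tX r \<mu> (2*k'+1) 0 = 0 \<and>
           (lambda_tX r \<mu> (2*k'+1) 0 = 0 \<longleftrightarrow> (\<Prod>k=1..2*k'+1. \<xi> (2*k'+1) k) = 0) \<and>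
           ((\<Prod>k=1..2*k'+1. \<xi> (2*k'+1) k) = 0 \<longleftrightarrow> poly (Pt r \<mu> (2*k'+1)) 0 = 0)) \<and>
        (\<forall>n\<ge>r'. lambda_tX r \<mu> (2*n+1) 0 = \<mu> * ((-1)^(n+1) / 2^(2*n)) \<and>
           (lambda_tX r \<mu> (2*n+1) 0 = \<mu> * ((-1)^(n+1) / 2^(2*n)) \<longleftrightarrow>
              (\<Prod>k=1..2*n+1. \<xi> (2*n+1) k) = \<mu> * ((-1)^n / 2^(2*n))) \<and>
           (\<mu> \<noteq> 0 \<longrightarrow> poly (Pt r \<mu> (2*n+1)) 0 \<noteq> 0)))"
proof -
  \<comment> \<open>For \<open>n = 0\<close> the index is -1, and the conventional value 0 agrees
    with the formula.\<close>
  have sub: "lambda_tX r \<mu> n (int n - 1) = (if r < n then - \<mu> else 0)" for n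
    by (cases n) (auto simp: lambda_tX_def coeff_Pt_subleading simp del: Pt.simps)
  have sum: "(\<Sum>i=1..n. \<xi> n i) = (if r < n then \<mu> else 0)" for n
  proof (cases n)
    case (Suc m)
    then show ?thesis
      using Pt_vieta(1)[OF zeros, of n] coeff_Pt_subleading[of r \<mu> m]
      by (auto simp del: Pt.simps sum.cl_ivl_Suc simp: neg_equal_iff_equal)
  qed simp
  have const: "lambda_tX r \<mu> n 0 = coeff (Pt r \<mu> n) 0" for n
    by (simp add: lambda_tX_def)
  \<comment> \<open>The Vieta sign \<open>(-1) ^ n\<close> depends only on parity, so the product of
    the zeros is plus or minus the constant coefficient.\<close>
  have ev: "(\<Prod>k=1..2*n. \<xi> (2*n) k) = coeff (Pt r \<mu> (2*n)) 0" for n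
    using Pt_vieta(2)[OF zeros, of "2*n"] by simp
  have od: "(\<Prod>k=1..2*n+1. \<xi> (2*n+1) k) = - coeff (Pt r \<mu> (2*n+1)) 0" for n
    using Pt_vieta(2)[OF zeros, of "2*n+1"] by simp
  \<comment> \<open>Every sum, product and value at 0 becomes an explicit closed form, so the
    equivalences reduce to comparing these forms.\<close>
  show ?thesis
    unfolding sub sum const ev od poly_0_coeff_0 coeff_0_Pt
    by auto
qed

end
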